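(* Suppose that $G\in C^2(\mathbb R^{n_x};\mathbb R^K)$ is locally Lipschitz with constant $c_{\mathrm{lip}}>0$ and that there is $b_{\mathrm{res}}>0$ such that $\|G(x_1)-G(x_2)-\mathrm DG(x_2)(x_1-x_2)\|\le b_{\mathrm{res}}\|x_1-x_2\|^2$ for all $x_1,x_2\in\mathbb R^{n_x}$. Then there exists a constant $b_1>0$, independent of $J$, such that for every solution $(u_t^{(j)})_{j=1,\dots,J}$ of the TEKI flow $$\frac{\mathrm du_t^{(j)}}{\mathrm dt}=C^{u,G}(u_t)\Gamma^{-1}(y-G(u_t^{(j)}))-C(u_t)C_0^{-1}u_t^{(j)},\qquad j=1,\dots,J,$$ it holds that $$\frac{\mathrm d}{\mathrm dt}\left(\frac1J\sum_{j=1}^J\Phi_R(u_t^{(j)})\right)\le-\frac1J\sum_{j=1}^J\langle\nabla\Phi_R(u_t^{(j)}),C(u_t)\nabla\Phi_R(u_t^{(j)})\rangle+b_1\,J\,V_e(t)^{3/2}\,\frac1J\sum_{j=1}^J\left(\frac12\|\nabla\Phi_R(u_t^{(j)})\|^2+\Phi_R(u_t^{(j)})\right),$$ where $V_e(t):=\frac1J\sum_{k=1}^J\|u_t^{(k)}-\bar u_t\|^2$.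
   Context: Let $n_x,K,J\in\mathbb N$ with $J\ge2$, let $y\in\mathbb R^K$ be fixed, let $G:\mathbb R^{n_x}\to\mathbb R^K$, and let $\Gamma\in\mathbb R^{K\times K}$, $C_0\in\mathbb R^{n_x\times n_x}$ be symmetric positive definite. $\|\cdot\|$ is the Euclidean norm, $\|v\|_\Gamma=\|\Gamma^{-1/2}v\|$ and $\|x\|_{C_0}=\|C_0^{-1/2}x\|$. Define $\Phi(x)=\frac12\|G(x)-y\|_\Gamma^2$ and $\Phi_R(x)=\Phi(x)+\frac12\|x\|_{C_0}^2$. For an ensemble $u=(u^{(j)})_{j=1,\dots,J}$ in $\mathbb R^{n_x}$ put $\bar u=\frac1J\sum_{j}u^{(j)}$, $\bar G=\frac1J\sum_jG(u^{(j)})$, $C(u)=\frac1J\sum_j(u^{(j)}-\bar u)(u^{(j)}-\bar u)^\top$ and $C^{u,G}(u)=\frac1J\sum_j(u^{(j)}-\bar u)(G(u^{(j)})-\bar G)^\top$. *)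

theory Defs
  imports "HOL-Analysis.Analysis"
begin

definition sym_pos_def :: "real^'n^'n \<Rightarrow> bool" where
  "sym_pos_def A \<longleftrightarrow> transpose A = A \<and> (\<forall>v. v \<noteq> 0 \<longrightarrow> 0 < v \<bullet> (A *v v))"

text \<open>The principal square root; the description is meant for symmetric positive definite \<open>A\<close>,
  where such an \<open>S\<close> exists and is unique.\<close>

definition spd_sqrt :: "real^'n^'n \<Rightarrow> real^'n^'n" where
  "spd_sqrt A = (THE S. sym_pos_def S \<and> S ** S = A)"

text \<open>\<open>wnorm A v\<close> is the weighted norm of \<open>v\<close>, that is, the Euclidean norm of
  \<open>A\<close> to the power \<open>-1/2\<close> applied to \<open>v\<close>.\<close>

definition wnorm :: "real^'n^'n \<Rightarrow> real^'n \<Rightarrow> real" where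
  "wnorm A v = norm (spd_sqrt (matrix_inv A) *v v)"

definition misfit :: "(real^'n \<Rightarrow> real^'k) \<Rightarrow> real^'k \<Rightarrow> real^'k^'k \<Rightarrow> real^'n \<Rightarrow> real" where
  "misfit G y \<Gamma> x = 1/2 * (wnorm \<Gamma> (G x - y))\<^sup>2"

definition reg_misfit ::
  "(real^'n \<Rightarrow> real^'k) \<Rightarrow> real^'k \<Rightarrow> real^'k^'k \<Rightarrow> real^'n^'n \<Rightarrow> real^'n \<Rightarrow> real" where
  "reg_misfit G y \<Gamma> C0 x = misfit G y \<Gamma> x + 1/2 * (wnorm C0 x)\<^sup>2"

definition gradient :: "('a::real_inner \<Rightarrow> real) \<Rightarrow> 'a \<Rightarrow> 'a" where
  "gradient f x = (THE D. GDERIV f x :> D)"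

definition C2_map :: "('a::real_normed_vector \<Rightarrow> 'b::real_normed_vector) \<Rightarrow> bool" where
  "C2_map f \<longleftrightarrow>
    (\<exists>(f' :: 'a \<Rightarrow> 'a \<Rightarrow>\<^sub>L 'b) (f'' :: 'a \<Rightarrow> 'a \<Rightarrow>\<^sub>L ('a \<Rightarrow>\<^sub>L 'b)).
      (\<forall>x. (f has_derivative blinfun_apply (f' x)) (at x)) \<and>
      (\<forall>x. (f' has_derivative blinfun_apply (f'' x)) (at x)) \<and>
      continuous_on UNIV f'')"

text \<open>The library predicate \<open>local_lipschitz\<close> lets the constant vary from point to point;
  here one constant \<open>L\<close> serves a neighbourhood of every point.\<close>

definition locally_lipschitz_const :: "real \<Rightarrow> ('a::metric_space \<Rightarrow> 'b::metric_space) \<Rightarrow> bool" where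
  "locally_lipschitz_const L f \<longleftrightarrow> (\<forall>x. \<exists>r>0. L-lipschitz_on (ball x r) f)"

text \<open>An ensemble of size \<open>J\<close> is a function on \<open>nat\<close> of which only the values
  at \<open>1, \<dots>, J\<close> are used.\<close>

definition ens_mean :: "nat \<Rightarrow> (nat \<Rightarrow> 'a::real_vector) \<Rightarrow> 'a" where
  "ens_mean J u = (1 / real J) *\<^sub>R (\<Sum>j=1..J. u j)"

definition outer_prod :: "real^'n \<Rightarrow> real^'m \<Rightarrow> real^'m^'n" where
  "outer_prod v w = (\<chi> a b. v $ a * w $ b)"

definition ens_cov :: "nat \<Rightarrow> (nat \<Rightarrow> real^'n) \<Rightarrow> real^'n^'n" where
  "ens_cov J u =
    (1 / real J) *\<^sub>R (\<Sum>j=1..J. outer_prod (u j - ens_mean J u) (u j - ens_mean J u))"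

definition ens_cross_cov ::
  "nat \<Rightarrow> (real^'n \<Rightarrow> real^'k) \<Rightarrow> (nat \<Rightarrow> real^'n) \<Rightarrow> real^'k^'n" where
  "ens_cross_cov J G u =
    (1 / real J) *\<^sub>R
      (\<Sum>j=1..J. outer_prod (u j - ens_mean J u) (G (u j) - ens_mean J (\<lambda>k. G (u k))))"

definition ens_var :: "nat \<Rightarrow> (nat \<Rightarrow> real^'n) \<Rightarrow> real" where
  "ens_var J u = 1 / real J * (\<Sum>k=1..J. (norm (u k - ens_mean J u))\<^sup>2)"

definition teki_rhs ::
  "(real^'n \<Rightarrow> real^'k) \<Rightarrow> real^'k \<Rightarrow> real^'k^'k \<Rightarrow> real^'n^'n \<Rightarrow> nat \<Rightarrow>
    (nat \<Rightarrow> real^'n) \<Rightarrow> nat \<Rightarrow> real^'n" where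
  "teki_rhs G y \<Gamma> C0 J u j =
    ens_cross_cov J G u *v (matrix_inv \<Gamma> *v (y - G (u j)))
    - ens_cov J u *v (matrix_inv C0 *v u j)"

text \<open>\<open>u t j\<close> is the position of particle \<open>j\<close> at time \<open>t\<close>. The time domain \<open>I\<close> is any
  nondegenerate interval; at an endpoint belonging to \<open>I\<close> the derivative is one-sided.\<close>

definition teki_solution ::
  "(real^'n \<Rightarrow> real^'k) \<Rightarrow> real^'k \<Rightarrow> real^'k^'k \<Rightarrow> real^'n^'n \<Rightarrow> nat \<Rightarrow>
    real set \<Rightarrow> (real \<Rightarrow> nat \<Rightarrow> real^'n) \<Rightarrow> bool" where
  "teki_solution G y \<Gamma> C0 J I u \<longleftrightarrow>
    is_interval I \<and> interior I \<noteq> {} \<and>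
    (\<forall>t\<in>I. \<forall>j\<in>{1..J}.
      ((\<lambda>s. u s j) has_vector_derivative teki_rhs G y \<Gamma> C0 J (u t) j) (at t within I))"

end

theory Submission
  imports Defs
begin

text \<open>
  Write \<open>g\<^sub>j\<close> for the gradient of \<open>\<Phi>\<^sub>R\<close> at \<open>u\<^sub>j\<close> and \<open>w\<^sub>j = \<Gamma>\<^sup>-\<^sup>1 (G u\<^sub>j - y)\<close>, so that
  \<open>g\<^sub>j = DG(u\<^sub>j)\<^sup>T w\<^sub>j + C\<^sub>0\<^sup>-\<^sup>1 u\<^sub>j\<close>. The flow is then a perturbed preconditioned gradient flow,
  \<open>u\<^sub>j' = - C(u) g\<^sub>j + (C(u) DG(u\<^sub>j)\<^sup>T - C\<^sup>u\<^sup>G(u)) w\<^sub>j\<close>, and by the chain rule the derivative of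
  the averaged potential is the stated dissipation plus the average of the inner products of \<open>g\<^sub>j\<close>
  with the perturbation.

  Since the deviations \<open>u\<^sub>k - m\<close> from the mean \<open>m\<close> sum to zero, the perturbation equals the
  average over \<open>k\<close> of
  \<open>((DG(u\<^sub>j)(u\<^sub>k - u\<^sub>j) - (G u\<^sub>k - G u\<^sub>j)) \<bullet> w\<^sub>j) (u\<^sub>k - m)\<close> (lemma \<open>cov_defect_eq\<close>), which only
  contains linearisation residuals. These are at most
  \<open>b_res \<parallel>u\<^sub>k - u\<^sub>j\<parallel>\<^sup>2 \<le> 2 b_res J V\<^sub>e\<close>, while the average of \<open>\<parallel>u\<^sub>k - m\<parallel>\<close> is at most \<open>\<surd>V\<^sub>e\<close>; the
  perturbation is therefore bounded by \<open>2 b_res J V\<^sub>e\<^sup>3\<^sup>/\<^sup>2 \<parallel>w\<^sub>j\<parallel>\<close> (lemma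
  \<open>norm_cov_defect_le\<close>). Finally \<open>\<parallel>g\<^sub>j\<parallel> \<parallel>w\<^sub>j\<parallel> \<le> \<parallel>g\<^sub>j\<parallel>\<^sup>2/2 + \<parallel>w\<^sub>j\<parallel>\<^sup>2/2\<close>, and \<open>\<parallel>w\<^sub>j\<parallel>\<^sup>2\<close> is bounded by a
  multiple of \<open>\<Phi>\<^sub>R(u\<^sub>j)\<close> that depends on \<open>\<Gamma>\<close> only.

  The weighted norms are defined through the principal square root, so it has to be shown that
  a symmetric positive definite matrix has exactly one symmetric positive definite square root.
  Existence comes from the contraction \<open>Y \<mapsto> (B + Y\<^sup>2)/2\<close>, whose fixed point satisfies
  \<open>(I - Y)\<^sup>2 = I - B\<close>; uniqueness comes from a trace identity.
\<close>

section \<open>Symmetric positive definite matrices\<close>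

lemma sym_pos_def_iff:
  fixes A :: "real^'n^'n"
  shows "sym_pos_def A \<longleftrightarrow>
    (\<forall>v w. (A *v v) \<bullet> w = v \<bullet> (A *v w)) \<and> (\<forall>v. v \<noteq> 0 \<longrightarrow> 0 < v \<bullet> (A *v v))"
proof -
  have *: "v \<bullet> (transpose A *v w) = (A *v v) \<bullet> w" for v w
    by (metis dot_lmul_matrix inner_commute transpose_matrix_vector)
  have "transpose A = A" if "\<forall>v w. (A *v v) \<bullet> w = v \<bullet> (A *v w)"
  proof -
    have "transpose A *v w = A *v w" for w
      by (rule vector_eq_rdot[THEN iffD1]) (metis * that inner_commute)
    then show ?thesis
      by (simp add: matrix_eq)
  qed
  with * show ?thesis
    unfolding sym_pos_def_def by metis
qed

lemma sym_pos_def_coercive: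
  fixes A :: "real^'n^'n"
  assumes "sym_pos_def A"
  obtains l where "l > 0" "\<And>v. l * (norm v)\<^sup>2 \<le> v \<bullet> (A *v v)"
proof -
  have "axis (undefined :: 'n) (1::real) \<in> sphere 0 1"
    by (simp add: norm_axis_1)
  then have "sphere (0 :: real^'n) 1 \<noteq> {}"
    by blast
  moreover have "continuous_on (sphere (0 :: real^'n) 1) (\<lambda>v. v \<bullet> (A *v v))"
    by (intro continuous_intros)
  ultimately obtain x :: "real^'n" where x: "norm x = 1"
    and min: "\<And>v. norm v = 1 \<Longrightarrow> x \<bullet> (A *v x) \<le> v \<bullet> (A *v v)"
    using continuous_attains_inf[OF compact_sphere, of 0 1 "\<lambda>v::real^'n. v \<bullet> (A *v v)"]
    by auto
  show thesis
  proof
    have "x \<noteq> 0"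
      using x by auto
    then show "x \<bullet> (A *v x) > 0"
      using assms by (simp add: sym_pos_def_iff)
    show "x \<bullet> (A *v x) * (norm v)\<^sup>2 \<le> v \<bullet> (A *v v)" for v
    proof (cases "v = 0")
      case False
      then have "x \<bullet> (A *v x) \<le> (v /\<^sub>R norm v) \<bullet> (A *v (v /\<^sub>R norm v))"
        by (intro min) simp
      also have "\<dots> = (v \<bullet> (A *v v)) / (norm v)\<^sup>2"
        by (simp add: scaleR_matrix_vector_assoc [symmetric] matrix_vector_mult_scaleR
            power2_eq_square field_simps)
      finally show ?thesis
        using False by (simp add: field_simps)
    qed simp
  qed
qed

lemma sym_pos_def_matrix_inv:
  fixes A :: "real^'n^'n"
  assumes "sym_pos_def A"
  shows "sym_pos_def (matrix_inv A)"
proof -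
  have "A *v x = 0 \<Longrightarrow> x = 0" for x
    using assms unfolding sym_pos_def_def by (metis inner_zero_right less_irrefl)
  then have "invertible A"
    by (simp add: invertible_left_inverse matrix_left_invertible_ker)
  then have "A ** matrix_inv A = mat 1"
    unfolding invertible_def matrix_inv_def by (rule someI2_ex) simp
  then have inv: "A *v (matrix_inv A *v x) = x" for x
    by (simp add: matrix_vector_mul_assoc)
  have sym: "(A *v v) \<bullet> w = v \<bullet> (A *v w)" and pos: "v \<noteq> 0 \<Longrightarrow> 0 < v \<bullet> (A *v v)" for v w
    using assms by (auto simp: sym_pos_def_iff)
  have "(matrix_inv A *v v) \<bullet> w = v \<bullet> (matrix_inv A *v w)" for v w
    by (metis inv sym)
  moreover have "0 < v \<bullet> (matrix_inv A *v v)" if "v \<noteq> 0" for v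
  proof -
    have "matrix_inv A *v v \<noteq> 0"
      using inv[of v] that by auto
    from pos[OF this] show ?thesis
      by (simp add: inv inner_commute)
  qed
  ultimately show ?thesis
    by (simp add: sym_pos_def_iff)
qed

section \<open>The principal square root\<close>

text \<open>With \<open>D = S - T\<close> and \<open>M = S + T\<close>, equality of the squares gives \<open>M D + D M = 0\<close>, whence
  \<open>D M D\<close> has trace zero. As \<open>M\<close> is positive definite, each diagonal entry of \<open>D M D\<close> is
  nonnegative, and vanishes only if the corresponding column of \<open>D\<close> does.\<close>

lemma sym_pos_def_sqrt_unique:
  fixes S T :: "real^'n^'n"
  assumes S: "sym_pos_def S" and T: "sym_pos_def T" and eq: "S ** S = T ** T"
  shows "S = T"
proof -
  define D M where "D = S - T" and "M = S + T"
  have symD: "(D *v v) \<bullet> w = v \<bullet> (D *v w)" for v w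
    using S T unfolding D_def sym_pos_def_iff
    by (simp add: matrix_vector_mult_diff_rdistrib inner_diff_left inner_diff_right)
  have posM: "0 < v \<bullet> (M *v v)" if "v \<noteq> 0" for v
    using S T that unfolding M_def sym_pos_def_iff
    by (simp add: matrix_vector_mult_add_rdistrib inner_add_right add_pos_pos)
  have anti: "(M ** D) *v v = - ((D ** M) *v v)" for v
  proof -
    have "S *v (S *v v) = T *v (T *v v)"
      by (simp add: matrix_vector_mul_assoc eq)
    then show ?thesis
      unfolding matrix_vector_mul_assoc[symmetric] D_def M_def
      by (simp add: algebra_simps)
  qed
  have "((M ** D) ** D) *v v = (- (D ** (M ** D))) *v v" for v
  proof -
    have "((M ** D) ** D) *v v = - ((D ** M) *v (D *v v))"
      by (simp only: matrix_vector_mul_assoc[symmetric, of "M ** D"] anti)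
    also have "\<dots> = - ((D ** (M ** D)) *v v)"
      by (simp only: matrix_vector_mul_assoc matrix_mul_assoc)
    also have "\<dots> = (- (D ** (M ** D))) *v v"
      by (simp add: vec_eq_iff matrix_vector_mult_def sum_negf)
    finally show ?thesis .
  qed
  then have "(M ** D) ** D = - (D ** (M ** D))"
    unfolding matrix_eq by blast
  then have "trace ((M ** D) ** D) = - trace (D ** (M ** D))"
    by (simp only: trace_def uminus_vec_def vec_lambda_beta sum_negf)
  moreover have "trace (D ** (M ** D)) = trace ((M ** D) ** D)"
    by (rule trace_mul_sym)
  ultimately have "trace (D ** (M ** D)) = 0"
    by simp
  moreover have "(D ** (M ** D)) $ i $ i = (D *v axis i 1) \<bullet> (M *v (D *v axis i 1))" for i
  proof -
    have "(D ** (M ** D)) $ i $ i = axis i 1 \<bullet> ((D ** (M ** D)) *v axis i 1)"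
      by (simp add: matrix_vector_mult_basis inner_axis' column_def)
    then show ?thesis
      by (simp add: symD matrix_vector_mul_assoc matrix_mul_assoc)
  qed
  ultimately have zero: "(\<Sum>i\<in>UNIV. (D *v axis i 1) \<bullet> (M *v (D *v axis i 1))) = 0"
    by (simp add: trace_def)
  have nonneg: "0 \<le> v \<bullet> (M *v v)" for v
    using posM[of v] by (cases "v = 0") auto
  have "(D *v axis i 1) \<bullet> (M *v (D *v axis i 1)) = 0" for i
    using zero by (subst (asm) sum_nonneg_eq_0_iff) (auto intro: nonneg)
  then have "D *v axis i 1 = 0" for i
    using posM by (metis less_irrefl)
  then have "D = 0"
    by (simp add: matrix_vector_mult_basis column_def vec_eq_iff)
  then show ?thesis
    by (simp add: D_def)
qed

text \<open>For small \<open>c > 0\<close> the matrix \<open>B = I - c A\<close> has operator norm at most some \<open>q < 1\<close>. On the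
  symmetric operators of norm at most \<open>q\<close>, the map \<open>Y \<mapsto> (B + Y\<^sup>2)/2\<close> is then a contraction; its
  fixed point satisfies \<open>(I - Y)\<^sup>2 = c A\<close>, and \<open>I - Y\<close> is positive definite because \<open>\<parallel>Y\<parallel> < 1\<close>.\<close>

lemma sym_pos_def_sqrt_ex:
  fixes A :: "real^'n^'n"
  assumes "sym_pos_def A"
  shows "\<exists>S. sym_pos_def S \<and> S ** S = A"
proof -
  obtain l where l: "l > 0" "\<And>v. l * (norm v)\<^sup>2 \<le> v \<bullet> (A *v v)"
    using sym_pos_def_coercive[OF assms] by blast
  obtain K where K: "K > 0" "\<And>v. norm (A *v v) \<le> norm v * K"
    using bounded_linear.pos_bounded[OF matrix_vector_mul_bounded_linear[of A]] by blast
  have symA: "(A *v v) \<bullet> w = v \<bullet> (A *v w)" for v w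
    using assms by (simp add: sym_pos_def_iff)
  \<comment> \<open>The scaling \<open>c\<close> minimises the bound \<open>1 - 2 c l + c\<^sup>2 K\<^sup>2\<close> for \<open>\<parallel>I - c A\<parallel>\<^sup>2\<close>,
    with minimum \<open>1 - l\<^sup>2 / K\<^sup>2\<close>; the maximum with \<open>0\<close> dispenses with a proof of \<open>l \<le> K\<close>.\<close>
  define c where "c = l / K\<^sup>2"
  define q where "q = sqrt (max 0 (1 - l\<^sup>2 / K\<^sup>2))"
  have c: "c > 0"
    using l K by (simp add: c_def)
  have q: "0 \<le> q" "q < 1"
    using l K by (auto simp: q_def intro!: real_sqrt_less_mono[of _ 1, simplified])
  define B where "B = Blinfun (\<lambda>v. v - c *\<^sub>R (A *v v))"
  have B: "blinfun_apply B v = v - c *\<^sub>R (A *v v)" for v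
    unfolding B_def by (subst bounded_linear_Blinfun_apply) (auto intro!: bounded_linear_intros)
  have normB: "norm B \<le> q"
  proof (rule norm_blinfun_bound)
    fix v
    have "(norm (A *v v))\<^sup>2 \<le> (norm v * K)\<^sup>2"
      using K(2) by (intro power_mono) auto
    then have "c\<^sup>2 * (norm (A *v v))\<^sup>2 \<le> c\<^sup>2 * (norm v * K)\<^sup>2"
      by (intro mult_left_mono) auto
    moreover have "2 * c * (l * (norm v)\<^sup>2) \<le> 2 * c * (v \<bullet> (A *v v))"
      using c l by (intro mult_left_mono) auto
    moreover have "(norm (blinfun_apply B v))\<^sup>2 =
        (norm v)\<^sup>2 - 2 * c * (v \<bullet> (A *v v)) + c\<^sup>2 * (norm (A *v v))\<^sup>2"
      unfolding B power2_norm_eq_inner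
      by (simp add: inner_diff_left inner_diff_right inner_commute power2_eq_square algebra_simps)
    ultimately have "(norm (blinfun_apply B v))\<^sup>2 \<le>
        (norm v)\<^sup>2 - 2 * c * (l * (norm v)\<^sup>2) + c\<^sup>2 * (norm v * K)\<^sup>2"
      by linarith
    also have "\<dots> = (1 - l\<^sup>2 / K\<^sup>2) * (norm v)\<^sup>2"
      using K(1) by (simp add: c_def field_simps power2_eq_square)
    also have "\<dots> \<le> q\<^sup>2 * (norm v)\<^sup>2"
      by (intro mult_right_mono) (auto simp: q_def)
    finally show "norm (blinfun_apply B v) \<le> q * norm v"
      using q(1) by (simp add: power_mult_distrib[symmetric] power2_le_iff_abs_le)
  qed (use q in auto)
  define X where
    "X = {Y :: (real^'n) \<Rightarrow>\<^sub>L (real^'n). norm Y \<le> q \<and>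
      (\<forall>v w. blinfun_apply Y v \<bullet> w = v \<bullet> blinfun_apply Y w)}"
  define F where "F Y = (1/2) *\<^sub>R (B + (Y o\<^sub>L Y))" for Y
  have "\<exists>!Y\<in>X. F Y = Y"
  proof (rule Banach_fix)
    have "closed X"
      unfolding X_def
      by (intro closed_Collect_conj closed_Collect_all closed_Collect_le closed_Collect_eq
          continuous_intros)
    then show "complete X"
      by (simp add: complete_eq_closed)
    have "0 \<in> X"
      using q by (simp add: X_def)
    then show "X \<noteq> {}"
      by blast
    show "F ` X \<subseteq> X"
    proof (rule image_subsetI)
      fix Y assume Y: "Y \<in> X"
      have "norm (B + (Y o\<^sub>L Y)) \<le> norm B + norm Y * norm Y"
        by (rule order_trans[OF norm_triangle_ineq add_left_mono[OF norm_blinfun_compose]])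
      then have "norm (F Y) \<le> (norm B + norm Y * norm Y) / 2"
        by (simp add: F_def)
      also have "\<dots> \<le> (q + 1 * q) / 2"
        using Y q normB by (intro divide_right_mono add_mono mult_mono) (auto simp: X_def)
      finally have "norm (F Y) \<le> q"
        by simp
      moreover have "blinfun_apply (F Y) v \<bullet> w = v \<bullet> blinfun_apply (F Y) w" for v w
        using Y unfolding F_def X_def
        by (simp add: blinfun.bilinear_simps B inner_add_left inner_add_right inner_diff_left
            inner_diff_right symA)
      ultimately show "F Y \<in> X"
        by (simp add: X_def)
    qed
    show "dist (F Y) (F Z) \<le> q * dist Y Z" if "Y \<in> X" "Z \<in> X" for Y Z
    proof -
      have "F Y - F Z = (1/2) *\<^sub>R ((Y o\<^sub>L (Y - Z)) + ((Y - Z) o\<^sub>L Z))"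
        by (rule blinfun_eqI) (simp add: F_def blinfun.bilinear_simps algebra_simps)
      then have "norm (F Y - F Z) \<le> (norm (Y o\<^sub>L (Y - Z)) + norm ((Y - Z) o\<^sub>L Z)) / 2"
        using norm_triangle_ineq[of "Y o\<^sub>L (Y - Z)" "(Y - Z) o\<^sub>L Z"] by simp
      also have "\<dots> \<le> (norm Y * norm (Y - Z) + norm (Y - Z) * norm Z) / 2"
        using norm_blinfun_compose by (intro divide_right_mono add_mono) auto
      also have "\<dots> \<le> (q * norm (Y - Z) + norm (Y - Z) * q) / 2"
        using that q by (intro divide_right_mono add_mono mult_mono) (auto simp: X_def)
      finally show ?thesis
        by (simp add: dist_norm mult.commute)
    qed
  qed (use q in auto)
  then obtain Y where "Y \<in> X" and fixpoint: "F Y = Y"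
    by blast
  then have normY: "norm Y \<le> q"
    and symY: "\<And>v w. blinfun_apply Y v \<bullet> w = v \<bullet> blinfun_apply Y w"
    by (auto simp: X_def)
  define S where "S = matrix (\<lambda>v. (1 / sqrt c) *\<^sub>R (v - blinfun_apply Y v))"
  have S: "S *v v = (1 / sqrt c) *\<^sub>R (v - blinfun_apply Y v)" for v
  proof -
    have "linear (\<lambda>v. (1 / sqrt c) *\<^sub>R (v - blinfun_apply Y v))"
      by (rule linearI) (simp_all add: blinfun.bilinear_simps algebra_simps)
    then show ?thesis
      unfolding S_def by (rule matrix_vector_mul(2)[THEN fun_cong])
  qed
  have "sym_pos_def S"
    unfolding sym_pos_def_iff
  proof (intro conjI allI impI)
    show "(S *v v) \<bullet> w = v \<bullet> (S *v w)" for v w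
      by (simp add: S inner_diff_left inner_diff_right symY)
    show "0 < v \<bullet> (S *v v)" if "v \<noteq> 0" for v
    proof -
      have "v \<bullet> blinfun_apply Y v \<le> norm v * norm (blinfun_apply Y v)"
        by (rule norm_cauchy_schwarz)
      also have "\<dots> \<le> norm v * (norm Y * norm v)"
        by (intro mult_left_mono norm_blinfun) auto
      also have "\<dots> \<le> norm v * (q * norm v)"
        using normY by (intro mult_left_mono mult_right_mono) auto
      also have "\<dots> < norm v * (1 * norm v)"
        using q that by (intro mult_strict_left_mono mult_strict_right_mono) auto
      finally have "v \<bullet> blinfun_apply Y v < v \<bullet> v"
        by (simp add: power2_norm_eq_inner[symmetric] power2_eq_square)
      then show ?thesis
        using c by (simp add: S inner_diff_right)
    qed
  qed
  moreover have "S ** S = A"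
  proof -
    have "S *v (S *v v) = A *v v" for v
    proof -
      have "2 *\<^sub>R blinfun_apply Y v = 2 *\<^sub>R blinfun_apply (F Y) v"
        by (simp only: fixpoint)
      also have "\<dots> = (v - c *\<^sub>R (A *v v)) + blinfun_apply Y (blinfun_apply Y v)"
        by (simp add: F_def blinfun.bilinear_simps B)
      finally have *: "v - 2 *\<^sub>R blinfun_apply Y v + blinfun_apply Y (blinfun_apply Y v) = c *\<^sub>R (A *v v)"
        by (simp add: algebra_simps)
      have "S *v (S *v v) =
          (1 / c) *\<^sub>R (v - 2 *\<^sub>R blinfun_apply Y v + blinfun_apply Y (blinfun_apply Y v))"
        using c by (simp add: S blinfun.bilinear_simps algebra_simps scaleR_2)
      then show ?thesis
        using c by (simp add: *)
    qed
    then show ?thesis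
      by (simp add: matrix_eq matrix_vector_mul_assoc)
  qed
  ultimately show ?thesis
    by blast
qed

lemma spd_sqrt:
  fixes A :: "real^'n^'n"
  assumes "sym_pos_def A"
  shows "sym_pos_def (spd_sqrt A)" and "spd_sqrt A ** spd_sqrt A = A"
proof -
  have "\<exists>!S. sym_pos_def S \<and> S ** S = A"
    using sym_pos_def_sqrt_ex[OF assms] sym_pos_def_sqrt_unique by metis
  from theI'[OF this] show "sym_pos_def (spd_sqrt A)" and "spd_sqrt A ** spd_sqrt A = A"
    by (auto simp: spd_sqrt_def)
qed

lemma wnorm_power2:
  fixes A :: "real^'n^'n"
  assumes "sym_pos_def A"
  shows "(wnorm A v)\<^sup>2 = v \<bullet> (matrix_inv A *v v)"
proof -
  note S = spd_sqrt[OF sym_pos_def_matrix_inv[OF assms]]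
  have "(wnorm A v)\<^sup>2 = v \<bullet> (spd_sqrt (matrix_inv A) *v (spd_sqrt (matrix_inv A) *v v))"
    using S(1) by (simp add: wnorm_def power2_norm_eq_inner sym_pos_def_iff)
  then show ?thesis
    by (simp add: matrix_vector_mul_assoc S(2))
qed

lemma norm_matrix_inv_le_wnorm:
  fixes A :: "real^'n^'n"
  assumes "sym_pos_def A"
  obtains K where "K > 0" "\<And>v. norm (matrix_inv A *v v) \<le> K * wnorm A v"
proof -
  obtain K where K: "K > 0" "\<And>v. norm (spd_sqrt (matrix_inv A) *v v) \<le> norm v * K"
    using bounded_linear.pos_bounded[OF matrix_vector_mul_bounded_linear] by blast
  have "norm (matrix_inv A *v v) \<le> K * wnorm A v" for v
    using K(2)[of "spd_sqrt (matrix_inv A) *v v"] spd_sqrt(2)[OF sym_pos_def_matrix_inv[OF assms]]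
    by (simp add: wnorm_def matrix_vector_mul_assoc mult.commute)
  with K(1) show thesis
    by (rule that)
qed

section \<open>The gradient of the regularised misfit\<close>

lemma gradient_eqI:
  assumes "GDERIV f x :> D"
  shows "gradient f x = D"
  unfolding gradient_def
proof (rule the_equality)
  fix E assume "GDERIV f x :> E"
  then have "(\<lambda>h. h \<bullet> E) = (\<lambda>h. h \<bullet> D)"
    using assms unfolding gderiv_def by (rule has_derivative_unique)
  then show "E = D"
    by (metis vector_eq_rdot inner_commute)
qed (fact assms)

lemma GDERIV_reg_misfit:
  fixes G :: "real^'n \<Rightarrow> real^'k"
  assumes \<Gamma>: "sym_pos_def \<Gamma>" and C0: "sym_pos_def C0" and L: "(G has_derivative L) (at x)"
  shows "GDERIV (reg_misfit G y \<Gamma> C0) x :>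
    adjoint L (matrix_inv \<Gamma> *v (G x - y)) + matrix_inv C0 *v x"
proof -
  have eq: "reg_misfit G y \<Gamma> C0 =
      (\<lambda>x. 1/2 * ((G x - y) \<bullet> (matrix_inv \<Gamma> *v (G x - y))) + 1/2 * (x \<bullet> (matrix_inv C0 *v x)))"
    by (simp add: fun_eq_iff reg_misfit_def misfit_def wnorm_power2[OF \<Gamma>] wnorm_power2[OF C0])
  have sym: "a \<bullet> (matrix_inv \<Gamma> *v b) = b \<bullet> (matrix_inv \<Gamma> *v a)"
    "c \<bullet> (matrix_inv C0 *v d) = d \<bullet> (matrix_inv C0 *v c)" for a b c d
    using sym_pos_def_matrix_inv[OF \<Gamma>] sym_pos_def_matrix_inv[OF C0]
    unfolding sym_pos_def_iff by (metis inner_commute)+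
  note [derivative_intros] =
    bounded_linear.has_derivative[OF matrix_vector_mul_bounded_linear[of "matrix_inv \<Gamma>"]]
    bounded_linear.has_derivative[OF matrix_vector_mul_bounded_linear[of "matrix_inv C0"]]
  have lin: "linear L"
    using L by (rule has_derivative_linear)
  have "h \<bullet> (adjoint L (matrix_inv \<Gamma> *v (G x - y)) + matrix_inv C0 *v x) =
      1/2 * ((G x - y) \<bullet> (matrix_inv \<Gamma> *v L h) + L h \<bullet> (matrix_inv \<Gamma> *v (G x - y))) +
      1/2 * (x \<bullet> (matrix_inv C0 *v h) + h \<bullet> (matrix_inv C0 *v x))" for h
    unfolding sym(1)[of "G x - y" "L h"] sym(2)[of x h]
    by (simp add: inner_add_right adjoint_works[OF lin])
  then show ?thesis
    unfolding eq gderiv_def by (auto intro!: derivative_eq_intros L simp: field_simps)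
qed

section \<open>Ensemble covariances\<close>

lemma outer_prod_mult_vec: "outer_prod v w *v x = (w \<bullet> x) *\<^sub>R v"
  by (simp add: vec_eq_iff outer_prod_def matrix_vector_mult_def inner_vec_def sum_distrib_left
      sum_distrib_right mult_ac)

lemma sum_matrix_vector_mult:
  fixes A :: "'i \<Rightarrow> real^'n^'m"
  shows "(\<Sum>i\<in>I. A i) *v x = (\<Sum>i\<in>I. A i *v x)"
  by (induction I rule: infinite_finite_induct) (auto simp: matrix_vector_mult_add_rdistrib)

lemma ens_cov_mult_vec:
  "ens_cov J u *v x =
    (1 / real J) *\<^sub>R (\<Sum>k=1..J. ((u k - ens_mean J u) \<bullet> x) *\<^sub>R (u k - ens_mean J u))"
  by (simp add: ens_cov_def scaleR_matrix_vector_assoc[symmetric] sum_matrix_vector_mult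
      outer_prod_mult_vec)

lemma ens_cross_cov_mult_vec:
  "ens_cross_cov J G u *v x =
    (1 / real J) *\<^sub>R (\<Sum>k=1..J. ((G (u k) - ens_mean J (\<lambda>k. G (u k))) \<bullet> x) *\<^sub>R (u k - ens_mean J u))"
  by (simp add: ens_cross_cov_def scaleR_matrix_vector_assoc[symmetric] sum_matrix_vector_mult
      outer_prod_mult_vec)

lemma sum_deviation_eq_0:
  assumes "J > 0"
  shows "(\<Sum>k=1..J. u k - ens_mean J u) = 0"
  using assms by (simp add: sum_subtractf sum_constant_scaleR ens_mean_def)

text \<open>Because the deviations from the mean sum to zero, the means inside the scalar factors may
  be replaced by the values at an arbitrary reference point \<open>x\<close>.\<close>

lemma cov_defect_eq:
  fixes G :: "real^'n \<Rightarrow> real^'k"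
  assumes "J > 0" and L: "linear L"
  shows "ens_cov J u *v adjoint L w - ens_cross_cov J G u *v w =
    (1 / real J) *\<^sub>R
      (\<Sum>k=1..J. ((L (u k - x) - (G (u k) - G x)) \<bullet> w) *\<^sub>R (u k - ens_mean J u))"
proof -
  let ?m = "ens_mean J u" and ?g = "ens_mean J (\<lambda>k. G (u k))"
  have "(\<Sum>k=1..J. ((u k - ?m) \<bullet> adjoint L w) *\<^sub>R (u k - ?m)) -
      (\<Sum>k=1..J. ((G (u k) - ?g) \<bullet> w) *\<^sub>R (u k - ?m)) =
      (\<Sum>k=1..J. ((L (u k - x) - (G (u k) - G x)) \<bullet> w) *\<^sub>R (u k - ?m) +
        ((L (x - ?m) - (G x - ?g)) \<bullet> w) *\<^sub>R (u k - ?m))"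
    unfolding sum_subtractf[symmetric]
    by (intro sum.cong refl)
      (simp add: adjoint_works[OF L] linear_diff[OF L] scaleR_add_left[symmetric]
        scaleR_diff_left[symmetric] inner_diff_left)
  also have "\<dots> = (\<Sum>k=1..J. ((L (u k - x) - (G (u k) - G x)) \<bullet> w) *\<^sub>R (u k - ?m)) +
      ((L (x - ?m) - (G x - ?g)) \<bullet> w) *\<^sub>R (\<Sum>k=1..J. u k - ?m)"
    by (simp only: sum.distrib scaleR_sum_right)
  finally show ?thesis
    unfolding ens_cov_mult_vec ens_cross_cov_mult_vec scaleR_diff_right[symmetric]
      sum_deviation_eq_0[OF assms(1)] by simp
qed

lemma ens_var_nonneg: "0 \<le> ens_var J u"
  by (simp add: ens_var_def sum_nonneg)

lemma mean_deviation_le: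
  assumes "J > 0"
  shows "1 / real J * (\<Sum>k=1..J. norm (u k - ens_mean J u)) \<le> sqrt (ens_var J u)"
proof (rule real_le_rsqrt)
  have "(\<Sum>k=1..J. norm (u k - ens_mean J u))\<^sup>2 \<le>
      (\<Sum>k=1..J. (norm (u k - ens_mean J u))\<^sup>2) * real J"
    using sum_squared_le_sum_of_squares[of "\<lambda>k. norm (u k - ens_mean J u)" "{1..J}"] by simp
  then show "(1 / real J * (\<Sum>k=1..J. norm (u k - ens_mean J u)))\<^sup>2 \<le> ens_var J u"
    using assms by (simp add: ens_var_def field_simps power2_eq_square)
qed

text \<open>For distinct particles the two squared deviations from the mean are distinct terms of the
  total \<open>J V\<^sub>e\<close>; this is where the factor \<open>J\<close> of the final estimate arises.\<close>

lemma dist_particles_le: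
  assumes "k \<in> {1..J}" "j \<in> {1..J}"
  shows "(norm (u k - u j))\<^sup>2 \<le> 2 * real J * ens_var J u"
proof (cases "k = j")
  case True
  then show ?thesis
    by (simp add: ens_var_nonneg)
next
  case False
  let ?d = "\<lambda>k. norm (u k - ens_mean J u)"
  have "norm (u k - u j) \<le> ?d k + ?d j"
    using norm_triangle_ineq4[of "u k - ens_mean J u" "u j - ens_mean J u"] by simp
  then have "(norm (u k - u j))\<^sup>2 \<le> (?d k + ?d j)\<^sup>2"
    by (intro power_mono) auto
  also have "\<dots> \<le> 2 * ((?d k)\<^sup>2 + (?d j)\<^sup>2)"
    using zero_le_power2[of "?d k - ?d j"] by (simp add: power2_eq_square algebra_simps)
  also have "(?d k)\<^sup>2 + (?d j)\<^sup>2 = (\<Sum>i\<in>{k, j}. (?d i)\<^sup>2)"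
    using False by simp
  also have "\<dots> \<le> (\<Sum>i=1..J. (?d i)\<^sup>2)"
    using assms by (intro sum_mono2) auto
  also have "\<dots> = real J * ens_var J u"
    using assms by (simp add: ens_var_def)
  finally show ?thesis
    by simp
qed

lemma norm_cov_defect_le:
  fixes G :: "real^'n \<Rightarrow> real^'k"
  assumes j: "j \<in> {1..J}" and L: "linear L" and b: "b \<ge> 0"
    and res: "\<And>z. norm (G z - G (u j) - L (z - u j)) \<le> b * (norm (z - u j))\<^sup>2"
  shows "norm (ens_cov J u *v adjoint L w - ens_cross_cov J G u *v w) \<le>
    2 * b * real J * ens_var J u powr (3/2) * norm w"
proof -
  let ?V = "ens_var J u" and ?m = "ens_mean J u"
  have J: "J > 0"
    using j by simp
  have term_le: "norm (((L (u k - u j) - (G (u k) - G (u j))) \<bullet> w) *\<^sub>R (u k - ?m)) \<le>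
      b * (2 * real J * ?V) * norm w * norm (u k - ?m)" if "k \<in> {1..J}" for k
  proof -
    have "norm (L (u k - u j) - (G (u k) - G (u j))) \<le> b * (norm (u k - u j))\<^sup>2"
      using res[of "u k"] by (simp add: norm_minus_commute)
    also have "\<dots> \<le> b * (2 * real J * ?V)"
      using b by (intro mult_left_mono dist_particles_le that j)
    finally have "\<bar>(L (u k - u j) - (G (u k) - G (u j))) \<bullet> w\<bar> \<le> b * (2 * real J * ?V) * norm w"
      by (meson Cauchy_Schwarz_ineq2 mult_right_mono norm_ge_zero order_trans)
    then show ?thesis
      by (simp add: mult_right_mono)
  qed
  have "norm (ens_cov J u *v adjoint L w - ens_cross_cov J G u *v w) \<le>
      1 / real J * (\<Sum>k=1..J. b * (2 * real J * ?V) * norm w * norm (u k - ?m))"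
    unfolding cov_defect_eq[OF J L, of u w G "u j"] norm_scaleR
    by (intro mult_mono sum_norm_le term_le) auto
  also have "\<dots> = b * (2 * real J * ?V) * norm w * (1 / real J * (\<Sum>k=1..J. norm (u k - ?m)))"
    by (simp add: sum_distrib_left[symmetric])
  also have "\<dots> \<le> b * (2 * real J * ?V) * norm w * sqrt ?V"
    using b ens_var_nonneg[of J u] by (intro mult_left_mono mean_deviation_le J) auto
  also have "\<dots> = 2 * b * real J * ?V powr (3/2) * norm w"
  proof -
    have "?V powr (3/2) = ?V powr (1 + 1/2)"
      by simp
    also have "\<dots> = ?V * sqrt ?V"
      unfolding powr_add using ens_var_nonneg[of J u] by (simp add: powr_half_sqrt)
    finally show ?thesis
      by (simp add: mult_ac)
  qed
  finally show ?thesis .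
qed

section \<open>Dissipation along the flow\<close>

text \<open>With \<open>L\<close> the derivative of \<open>G\<close> at \<open>u j\<close>, this splits the right-hand side of the flow into the
  covariance defect and the preconditioned negative gradient. The identity itself holds for
  every \<open>L\<close>.\<close>

lemma teki_rhs_eq:
  fixes G :: "real^'n \<Rightarrow> real^'k"
  shows "teki_rhs G y \<Gamma> C0 J u j =
    (ens_cov J u *v adjoint L (matrix_inv \<Gamma> *v (G (u j) - y)) -
      ens_cross_cov J G u *v (matrix_inv \<Gamma> *v (G (u j) - y))) -
    ens_cov J u *v (adjoint L (matrix_inv \<Gamma> *v (G (u j) - y)) + matrix_inv C0 *v u j)"
  by (simp add: teki_rhs_def algebra_simps)

theorem proposition3p3:
  fixes G :: "real^'n \<Rightarrow> real^'k" and y :: "real^'k"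
    and \<Gamma> :: "real^'k^'k" and C0 :: "real^'n^'n"
    and c_lip b_res :: real
  assumes "sym_pos_def \<Gamma>" and "sym_pos_def C0"
    and "C2_map G"
    and "c_lip > 0" and "locally_lipschitz_const c_lip G"
    and "b_res > 0"
    and "\<And>x1 x2. norm (G x1 - G x2 - frechet_derivative G (at x2) (x1 - x2))
                   \<le> b_res * (norm (x1 - x2))\<^sup>2"
  shows "\<exists>b1>0. \<forall>J\<ge>2. \<forall>I u. teki_solution G y \<Gamma> C0 J I u \<longrightarrow>
    (\<forall>t\<in>I. \<exists>D.
      ((\<lambda>s. 1 / real J * (\<Sum>j=1..J. reg_misfit G y \<Gamma> C0 (u s j)))
        has_real_derivative D) (at t within I) \<and>
      D \<le> - (1 / real J) *
             (\<Sum>j=1..J. gradient (reg_misfit G y \<Gamma> C0) (u t j) \<bullet>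
                        (ens_cov J (u t) *v gradient (reg_misfit G y \<Gamma> C0) (u t j)))
          + b1 * real J * ens_var J (u t) powr (3/2) *
            (1 / real J *
             (\<Sum>j=1..J. 1/2 * (norm (gradient (reg_misfit G y \<Gamma> C0) (u t j)))\<^sup>2
                        + reg_misfit G y \<Gamma> C0 (u t j))))"
proof -
  let ?\<Phi> = "reg_misfit G y \<Gamma> C0"
  define L where "L x = frechet_derivative G (at x)" for x
  define g where "g x = gradient ?\<Phi> x" for x
  define w where "w x = matrix_inv \<Gamma> *v (G x - y)" for x
  have L: "(G has_derivative L x) (at x)" for x
    using \<open>C2_map G\<close> unfolding C2_map_def L_def by (metis frechet_derivative_at)
  have lin: "linear (L x)" for x
    using L by (rule has_derivative_linear)
  have grad: "GDERIV ?\<Phi> x :> g x" and g_eq: "g x = adjoint (L x) (w x) + matrix_inv C0 *v x" for x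
    using GDERIV_reg_misfit[OF assms(1,2) L, of y x] gradient_eqI[OF GDERIV_reg_misfit[OF assms(1,2) L]]
    by (auto simp: g_def w_def)
  obtain K where K: "K > 0" "\<And>v. norm (matrix_inv \<Gamma> *v v) \<le> K * wnorm \<Gamma> v"
    using norm_matrix_inv_le_wnorm[OF assms(1)] by blast
  have gw_le: "norm (g x) * norm (w x) \<le> (1 + K\<^sup>2) * (1/2 * (norm (g x))\<^sup>2 + ?\<Phi> x)" for x
  proof -
    have "(norm (w x))\<^sup>2 \<le> (K * wnorm \<Gamma> (G x - y))\<^sup>2"
      unfolding w_def using K(2) by (intro power_mono) auto
    also have "\<dots> \<le> K\<^sup>2 * (2 * ?\<Phi> x)"
      unfolding power_mult_distrib
      by (intro mult_left_mono) (auto simp: reg_misfit_def misfit_def)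
    finally have "(norm (w x))\<^sup>2 \<le> K\<^sup>2 * (2 * ?\<Phi> x)" .
    moreover have "norm (g x) * norm (w x) \<le> 1/2 * (norm (g x))\<^sup>2 + 1/2 * (norm (w x))\<^sup>2"
      using zero_le_power2[of "norm (g x) - norm (w x)"]
      by (simp add: power2_eq_square algebra_simps)
    ultimately have "norm (g x) * norm (w x) \<le> 1 * (1/2 * (norm (g x))\<^sup>2) + K\<^sup>2 * ?\<Phi> x"
      by simp
    also have "\<dots> \<le> (1 + K\<^sup>2) * (1/2 * (norm (g x))\<^sup>2) + (1 + K\<^sup>2) * ?\<Phi> x"
      by (intro add_mono mult_right_mono) (auto simp: reg_misfit_def misfit_def)
    also have "\<dots> = (1 + K\<^sup>2) * (1/2 * (norm (g x))\<^sup>2 + ?\<Phi> x)"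
      by (rule distrib_left[symmetric])
    finally show ?thesis .
  qed
  \<comment> \<open>The factor \<open>2 b_res\<close> stems from the covariance defect, \<open>1 + K\<^sup>2\<close> from \<open>gw_le\<close>.\<close>
  define b1 where "b1 = 2 * b_res * (1 + K\<^sup>2)"
  have "b1 > 0"
    using \<open>b_res > 0\<close> by (simp add: b1_def add_pos_nonneg)
  moreover have "\<exists>D. ((\<lambda>s. 1 / real J * (\<Sum>j=1..J. ?\<Phi> (u s j))) has_real_derivative D) (at t within I) \<and>
      D \<le> - (1 / real J) * (\<Sum>j=1..J. g (u t j) \<bullet> (ens_cov J (u t) *v g (u t j)))
          + b1 * real J * ens_var J (u t) powr (3/2) *
            (1 / real J * (\<Sum>j=1..J. 1/2 * (norm (g (u t j)))\<^sup>2 + ?\<Phi> (u t j)))"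
    if sol: "teki_solution G y \<Gamma> C0 J I u" and t: "t \<in> I" for J I u t
  proof -
    define v where "v j = teki_rhs G y \<Gamma> C0 J (u t) j" for j
    define R where "R = real J * ens_var J (u t) powr (3/2)"
    have deriv: "((\<lambda>s. ?\<Phi> (u s j)) has_real_derivative (v j \<bullet> g (u t j))) (at t within I)"
      if "j \<in> {1..J}" for j
    proof -
      have "((\<lambda>s. u s j) has_vector_derivative v j) (at t within I)"
        using sol t that by (auto simp: teki_solution_def v_def)
      moreover have "(?\<Phi> has_derivative (\<lambda>h. h \<bullet> g (u t j))) (at (u t j) within (\<lambda>s. u s j) ` I)"
        using grad[of "u t j"] unfolding gderiv_def by (rule has_derivative_at_withinI)
      ultimately show ?thesis
        using vector_derivative_diff_chain_within[of "\<lambda>s. u s j" "v j" t I ?\<Phi> "\<lambda>h. h \<bullet> g (u t j)"]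
        by (simp add: o_def has_real_derivative_iff_has_vector_derivative)
    qed
    have le: "v j \<bullet> g (u t j) \<le> - (g (u t j) \<bullet> (ens_cov J (u t) *v g (u t j))) +
        b1 * R * (1/2 * (norm (g (u t j)))\<^sup>2 + ?\<Phi> (u t j))" if j: "j \<in> {1..J}" for j
    proof -
      let ?x = "u t j"
      let ?E = "ens_cov J (u t) *v adjoint (L ?x) (w ?x) - ens_cross_cov J G (u t) *v w ?x"
      have "v j = ?E - ens_cov J (u t) *v g ?x"
        unfolding v_def g_eq w_def by (rule teki_rhs_eq)
      then have "v j \<bullet> g ?x = ?E \<bullet> g ?x - g ?x \<bullet> (ens_cov J (u t) *v g ?x)"
        by (simp only: inner_diff_left inner_commute[of "g (u t j)"])
      moreover have "?E \<bullet> g ?x \<le> b1 * R * (1/2 * (norm (g ?x))\<^sup>2 + ?\<Phi> ?x)"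
      proof -
        have "?E \<bullet> g ?x \<le> norm ?E * norm (g ?x)"
          by (rule norm_cauchy_schwarz)
        also have "norm ?E \<le> 2 * b_res * real J * ens_var J (u t) powr (3/2) * norm (w ?x)"
          using assms(6,7) by (intro norm_cov_defect_le[OF j lin]) (auto simp: L_def)
        then have "norm ?E * norm (g ?x) \<le> 2 * b_res * R * norm (w ?x) * norm (g ?x)"
          by (intro mult_right_mono) (auto simp: R_def mult_ac)
        also have "\<dots> = 2 * b_res * R * (norm (g ?x) * norm (w ?x))"
          by simp
        also have "\<dots> \<le> 2 * b_res * R * ((1 + K\<^sup>2) * (1/2 * (norm (g ?x))\<^sup>2 + ?\<Phi> ?x))"
          using \<open>b_res > 0\<close> by (intro mult_left_mono gw_le) (auto simp: R_def)
        finally show ?thesis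
          by (simp only: b1_def mult_ac)
      qed
      ultimately show ?thesis
        by simp
    qed
    have "((\<lambda>s. 1 / real J * (\<Sum>j=1..J. ?\<Phi> (u s j))) has_real_derivative
        1 / real J * (\<Sum>j=1..J. v j \<bullet> g (u t j))) (at t within I)"
      by (intro DERIV_cmult DERIV_sum deriv)
    moreover have "1 / real J * (\<Sum>j=1..J. v j \<bullet> g (u t j)) \<le> 1 / real J *
        (\<Sum>j=1..J. - (g (u t j) \<bullet> (ens_cov J (u t) *v g (u t j))) +
          b1 * R * (1/2 * (norm (g (u t j)))\<^sup>2 + ?\<Phi> (u t j)))"
      by (intro mult_left_mono sum_mono le) auto
    moreover have "\<dots> = - (1 / real J) * (\<Sum>j=1..J. g (u t j) \<bullet> (ens_cov J (u t) *v g (u t j)))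
          + b1 * real J * ens_var J (u t) powr (3/2) *
            (1 / real J * (\<Sum>j=1..J. 1/2 * (norm (g (u t j)))\<^sup>2 + ?\<Phi> (u t j)))"
      unfolding sum.distrib[of "\<lambda>j. - (g (u t j) \<bullet> (ens_cov J (u t) *v g (u t j)))"]
        sum_distrib_left[symmetric] sum_negf R_def
      by (simp only: distrib_left mult_ac mult_minus_left mult_minus_right)
    ultimately show ?thesis
      by (metis (no_types, lifting))
  qed
  ultimately show ?thesis
    unfolding g_def by blast
qed

end
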